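(* Let $\kappa$ be an uncountable cardinal with $\kappa^{<\kappa}=\kappa$. Then the $G_0^\kappa$-dichotomy fails for closed graphs on ${}^\kappa 2$: there exists a closed graph $G$ on ${}^\kappa 2$ such that $G$ admits no $\kappa$-Borel measurable coloring with at most $\kappa$ many colors and there is no continuous homomorphism from $G_0^\kappa$ to $G$.
   Context: ${}^\kappa 2$ is the set of functions $\kappa\to\{0,1\}$ with the bounded topology, whose basic open sets are $N_t=\{x\in{}^\kappa 2\mid t\subseteq x\}$ for $t\in{}^{<\kappa}2$ (binary sequences of length $<\kappa$). Subsets carry the subspace topology and ${}^\kappa2\times{}^\kappa2$ the product topology. The $\kappa$-Borel sets form the smallest class containing the open sets and closed under complements and unions of length $\kappa$. A graph on a set $X$ is a symmetric subset $G$ of $(X\times X)\setminus\Delta_X$, where $\Delta_X=\{(x,x)\mid x\in X\}$; $(x,y)$ and $(y,x)$ represent the same edge. A graph on $X$ is closed if it is a closed subset of $(X\times X)\setminus\Delta_X$. A $\kappa$-Borel measurable coloring of $G$ with at most $\kappa$ colors is a map $c\colon X\to\kappa$ with $c(x)\neq c(y)$ for all $(x,y)\in G$ and all sets $c^{-1}(\{\alpha\})$ $\kappa$-Borel (relative to $X$). A homomorphism from a graph $G$ on $X$ to a graph $H$ on $Y$ is a map $f\colon X\to Y$ with $(f(x),f(y))\in H$ for all $(x,y)\in G$. Fix an upwards dense subset $S$ of ${}^{<\kappa}2$ (every $t\in{}^{<\kappa}2$ is extended by some $u\in S$, $u\supseteq t$) containing at most one sequence of each length $i<\kappa$. $G_0^\kappa=G_0^\kappa(S)$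 is the graph on ${}^\kappa2$ whose edges are the pairs $(t^\frown 0^\frown x,\ t^\frown 1^\frown x)$ with $t\in S$ and $x\in{}^\kappa2$ (and their reversals). The $G_0^\kappa$-dichotomy for a graph $G$ states that either $G$ admits a $\kappa$-Borel measurable coloring with at most $\kappa$ many colors, or there is a continuous homomorphism from $G_0^\kappa$ to $G$. *)

theory Defs
  imports "HOL-Analysis.Analysis"
begin

unbundle cardinal_syntax

text \<open>
  The cardinal \<open>\<kappa>\<close> is represented by a type \<open>'k::wellorder\<close>: the elements of \<open>'k\<close> are the ordinals
  below \<open>\<kappa>\<close>, and \<open>\<kappa>\<close> being a cardinal (an initial ordinal) is the assumption
  \<open>Card_order kappa\<close> on the order of the type. The set of functions from \<open>\<kappa>\<close> to \<open>{0,1}\<close> is then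
  the type \<open>'k \<Rightarrow> bool\<close>, with \<open>False\<close> for 0 and \<open>True\<close> for 1.
\<close>

definition kappa :: "'k::wellorder rel" where
  "kappa = {(\<alpha>, \<beta>). \<alpha> \<le> \<beta>}"

text \<open>Sequences of length less than \<open>\<kappa>\<close>, as partial functions on proper initial segments of \<open>\<kappa>\<close>.\<close>

definition short_seqs :: "('k::wellorder \<rightharpoonup> 'b) set" where
  "short_seqs = {t. \<exists>\<alpha>. dom t = {..<\<alpha>}}"

definition seq_length :: "('k::wellorder \<rightharpoonup> 'b) \<Rightarrow> 'k" where
  "seq_length t = (THE \<alpha>. dom t = {..<\<alpha>})"

definition seq_snoc :: "('k::wellorder \<rightharpoonup> 'b) \<Rightarrow> 'b \<Rightarrow> ('k \<rightharpoonup> 'b)" where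
  "seq_snoc t b = t(seq_length t \<mapsto> b)"

text \<open>
  Ordinal addition: \<open>\<alpha> + \<gamma>\<close> is the least ordinal that is at least \<open>\<alpha>\<close> and larger than all
  \<open>\<alpha> + \<delta>\<close> with \<open>\<delta> < \<gamma>\<close>. It is total on \<open>\<kappa>\<close> because infinite cardinals are closed under ordinal
  addition.
\<close>

function ord_plus :: "'k::wellorder \<Rightarrow> 'k \<Rightarrow> 'k" where
  "ord_plus \<alpha> \<gamma> = (LEAST \<beta>. \<alpha> \<le> \<beta> \<and> (\<forall>\<delta>\<in>{..<\<gamma>}. ord_plus \<alpha> \<delta> < \<beta>))"
  by pat_completeness auto
termination
  by (relation "inv_image {(\<alpha>, \<beta>). \<alpha> < \<beta>} snd") (auto intro: wf)

declare ord_plus.simps [simp del]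

text \<open>The concatenation of \<open>t\<close> with \<open>x\<close>: its value at \<open>length t + \<gamma>\<close> is \<open>x \<gamma>\<close>.\<close>

definition seq_concat :: "('k::wellorder \<rightharpoonup> 'b) \<Rightarrow> ('k \<Rightarrow> 'b) \<Rightarrow> ('k \<Rightarrow> 'b)" where
  "seq_concat t x = (\<lambda>\<beta>. case t \<beta> of
      Some b \<Rightarrow> b
    | None \<Rightarrow> x (THE \<gamma>. ord_plus (seq_length t) \<gamma> = \<beta>))"

definition basic_open :: "('k::wellorder \<rightharpoonup> bool) \<Rightarrow> ('k \<Rightarrow> bool) set" where
  "basic_open t = {x. t \<subseteq>\<^sub>m Some \<circ> x}"

definition bounded_topology :: "('k::wellorder \<Rightarrow> bool) topology" where
  "bounded_topology = topology_generated_by (basic_open ` short_seqs)"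

inductive_set kappa_Borel :: "('k::wellorder \<Rightarrow> bool) set set" where
  Open: "openin bounded_topology U \<Longrightarrow> U \<in> kappa_Borel"
| Compl: "A \<in> kappa_Borel \<Longrightarrow> - A \<in> kappa_Borel"
| Union: "(\<And>\<alpha>::'k. A \<alpha> \<in> kappa_Borel) \<Longrightarrow> (\<Union>\<alpha>. A \<alpha>) \<in> kappa_Borel"

definition graph_on :: "'a set \<Rightarrow> 'a rel \<Rightarrow> bool" where
  "graph_on X G \<longleftrightarrow> sym G \<and> G \<subseteq> X \<times> X - Id_on X"

text \<open>Closed in the complement of the diagonal, not in the whole product.\<close>

definition closed_graph :: "'a topology \<Rightarrow> 'a rel \<Rightarrow> bool" where
  "closed_graph T G \<longleftrightarrow> graph_on (topspace T) G \<and>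
     closedin (subtopology (prod_topology T T)
       (topspace T \<times> topspace T - Id_on (topspace T))) G"

definition kappa_Borel_coloring ::
    "('k::wellorder \<Rightarrow> bool) rel \<Rightarrow> (('k \<Rightarrow> bool) \<Rightarrow> 'k) \<Rightarrow> bool" where
  "kappa_Borel_coloring G c \<longleftrightarrow>
     (\<forall>(x, y)\<in>G. c x \<noteq> c y) \<and> (\<forall>\<alpha>. c -` {\<alpha>} \<in> kappa_Borel)"

definition graph_hom :: "'a set \<Rightarrow> 'a rel \<Rightarrow> 'b set \<Rightarrow> 'b rel \<Rightarrow> ('a \<Rightarrow> 'b) \<Rightarrow> bool" where
  "graph_hom X G Y H f \<longleftrightarrow> f ` X \<subseteq> Y \<and> (\<forall>(x, y)\<in>G. (f x, f y) \<in> H)"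

definition upwards_dense :: "('k::wellorder \<rightharpoonup> bool) set \<Rightarrow> bool" where
  "upwards_dense S \<longleftrightarrow> S \<subseteq> short_seqs \<and> (\<forall>t\<in>short_seqs. \<exists>u\<in>S. t \<subseteq>\<^sub>m u)"

definition G0_graph :: "('k::wellorder \<rightharpoonup> bool) set \<Rightarrow> ('k \<Rightarrow> bool) rel" where
  "G0_graph S = (let E = {(seq_concat (seq_snoc t False) x, seq_concat (seq_snoc t True) x) | t x. t \<in> S}
     in E \<union> E\<inverse>)"

end

theory Submission
  imports Defs
begin

text \<open>
  Fix a labelling of \<open>\<kappa>\<close> by \<open>\<kappa>\<close> in which every label occurs unboundedly often. Join two sequences
  \<open>x\<close> and \<open>y\<close> with first difference \<open>i\<close> if, for every common limit \<open>\<delta> > i\<close> of positions of ones of \<open>x\<close>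
  and of \<open>y\<close>, the first one of \<open>x\<close> at or above \<open>\<delta>\<close> has label \<open>i\<close>, and likewise for \<open>y\<close>. A violation is
  seen by bounded initial segments, so this graph is closed off the diagonal.

  By the Baire property, some colour class of a \<open>\<kappa>\<close>-Borel colouring is comeager in a basic open set.
  There an edge is built by fusion: \<open>x\<close> and \<open>y\<close> are extended into the dense open sets in turns, the
  other one staying zero meanwhile, so that common limits of ones appear only at limit stages.

  For \<open>x\<close> and its neighbours with unboundedly many ones, limits of ones are club, so any two
  neighbours share such a limit with \<open>x\<close>, and the label read there shows that both first differ from
  \<open>x\<close> at the same \<open>i\<close>: no neighbours converge to \<open>x\<close>. In the graph \<open>G\<^sub>0\<close>, in contrast, a generic point is a limit
  of neighbours, and only \<open>\<kappa>\<close> many sequences, which generic points avoid, are eventually zero.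
\<close>

subsection \<open>The bounded topology\<close>

text \<open>The basic open sets, indexed by a total point and a height instead of a partial
  function. The value type is general because fusion also runs on sequences of pairs.\<close>

definition cylinder :: "('k::wellorder \<Rightarrow> 'b) \<Rightarrow> 'k \<Rightarrow> ('k \<Rightarrow> 'b) set" where
  "cylinder x a = {y. \<forall>\<xi><a. y \<xi> = x \<xi>}"

definition next_ord :: "'k::wellorder \<Rightarrow> 'k" where
  "next_ord a = (LEAST b. a < b)"

lemma cylinder_refl [simp]: "x \<in> cylinder x a"
  by (simp add: cylinder_def)

lemma cylinder_sym: "y \<in> cylinder x a \<longleftrightarrow> x \<in> cylinder y a"
  by (auto simp: cylinder_def)

lemma cylinder_trans: "y \<in> cylinder x a \<Longrightarrow> z \<in> cylinder y b \<Longrightarrow> a \<le> b \<Longrightarrow> z \<in> cylinder x a"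
  by (auto simp: cylinder_def)

lemma cylinder_mono: "a \<le> b \<Longrightarrow> cylinder x b \<subseteq> cylinder x a"
  by (auto simp: cylinder_def)

lemma cylinderD: "y \<in> cylinder x a \<Longrightarrow> \<xi> < a \<Longrightarrow> y \<xi> = x \<xi>"
  by (simp add: cylinder_def)

lemma cylinder_eq_basic_open:
  "cylinder x a = basic_open (\<lambda>\<xi>. if \<xi> < a then Some (x \<xi>) else None)"
  by (auto simp: cylinder_def basic_open_def map_le_def dom_def split: if_splits)

lemma restrict_short_seqs: "(\<lambda>\<xi>. if \<xi> < a then Some (x \<xi>) else None) \<in> short_seqs"
  by (auto simp: short_seqs_def dom_def)

lemma openin_cylinder: "openin bounded_topology (cylinder x a)"
  unfolding bounded_topology_def cylinder_eq_basic_open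
  by (rule topology_generated_by_Basis) (use restrict_short_seqs in blast)

lemma basic_open_cylinder:
  assumes "dom t = {..<a}" "x \<in> basic_open t"
  shows "basic_open t = cylinder x a"
  using assms by (auto simp: basic_open_def cylinder_def map_le_def)

text \<open>A basic open set is a cylinder around each of its points, and the cylinders around one
  point are nested. Hence they form a neighbourhood base.\<close>

lemma openin_bounded_topology_iff:
  "openin bounded_topology U \<longleftrightarrow> (\<forall>x\<in>U. \<exists>a. cylinder x a \<subseteq> U)"
proof
  assume "openin bounded_topology U"
  then have "generate_topology_on (basic_open ` short_seqs) U"
    unfolding bounded_topology_def by (rule openin_topology_generated_by)
  then show "\<forall>x\<in>U. \<exists>a. cylinder x a \<subseteq> U"
  proof induction
    case (Int A B)
    show ?case
    proof
      fix x assume "x \<in> A \<inter> B"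
      then obtain a b where "cylinder x a \<subseteq> A" "cylinder x b \<subseteq> B" using Int by blast
      then have "cylinder x (max a b) \<subseteq> A \<inter> B"
        using cylinder_mono[of a "max a b" x] cylinder_mono[of b "max a b" x] by auto
      then show "\<exists>a. cylinder x a \<subseteq> A \<inter> B" by blast
    qed
  next
    case (UN K)
    then show ?case by (meson Union_iff Union_upper order_trans)
  next
    case (Basis s)
    then obtain t a where "s = basic_open t" "dom t = {..<a}" by (auto simp: short_seqs_def)
    then show ?case using basic_open_cylinder by blast
  qed auto
next
  assume *: "\<forall>x\<in>U. \<exists>a. cylinder x a \<subseteq> U"
  show "openin bounded_topology U"
    unfolding openin_subopen[of _ U] using * openin_cylinder cylinder_refl by metis
qed

lemma topspace_bounded_topology [simp]: "topspace bounded_topology = UNIV"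
  using openin_subset[of bounded_topology UNIV] by (auto simp: openin_bounded_topology_iff)

lemma continuous_bounded_topologyD:
  assumes "continuous_map bounded_topology bounded_topology f"
  shows "\<exists>a. f ` cylinder x a \<subseteq> cylinder (f x) b"
proof -
  have "openin bounded_topology {y. f y \<in> cylinder (f x) b}"
    using openin_continuous_map_preimage[OF assms openin_cylinder[of "f x" b]] by simp
  then obtain a where "cylinder x a \<subseteq> {y. f y \<in> cylinder (f x) b}"
    unfolding openin_bounded_topology_iff using cylinder_refl by blast
  then show ?thesis by blast
qed

section \<open>Dense open sets and changes of a single coordinate\<close>

definition dense_open :: "('k::wellorder \<Rightarrow> bool) set \<Rightarrow> bool" where
  "dense_open D \<longleftrightarrow> (\<forall>x\<in>D. \<exists>a. cylinder x a \<subseteq> D) \<and> (\<forall>x a. \<exists>y\<in>D. y \<in> cylinder x a)"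

lemma dense_open_UNIV: "dense_open UNIV"
  unfolding dense_open_def using cylinder_refl by blast

lemma dense_open_extend:
  assumes "dense_open D"
  obtains y b where "y \<in> cylinder x a" "a \<le> b" "cylinder y b \<subseteq> D"
proof -
  obtain y b where "y \<in> D" "y \<in> cylinder x a" "cylinder y b \<subseteq> D"
    using assms by (meson dense_open_def)
  with cylinder_mono[of b "max a b" y] show thesis by (intro that[of y "max a b"]) auto
qed

lemma dense_open_Int:
  assumes "dense_open D" "dense_open E" shows "dense_open (D \<inter> E)"
  unfolding dense_open_def
proof (intro conjI ballI allI)
  fix x assume "x \<in> D \<inter> E"
  then obtain a b where "cylinder x a \<subseteq> D" "cylinder x b \<subseteq> E"
    using assms by (meson IntE dense_open_def)
  then have "cylinder x (max a b) \<subseteq> D \<inter> E"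
    using cylinder_mono[of a "max a b" x] cylinder_mono[of b "max a b" x] by auto
  then show "\<exists>a. cylinder x a \<subseteq> D \<inter> E" by blast
next
  fix x a
  obtain y b where y: "y \<in> cylinder x a" "a \<le> b" "cylinder y b \<subseteq> D"
    using dense_open_extend[OF assms(1)] .
  obtain z c where z: "z \<in> cylinder y b" "b \<le> c" "cylinder z c \<subseteq> E"
    using dense_open_extend[OF assms(2)] .
  have "z \<in> cylinder x a" using cylinder_trans[OF y(1) z(1) y(2)] .
  moreover have "z \<in> D \<inter> E" using y z cylinder_refl by blast
  ultimately show "\<exists>y\<in>D \<inter> E. y \<in> cylinder x a" by blast
qed

definition flip :: "'k \<Rightarrow> ('k \<Rightarrow> bool) \<Rightarrow> ('k \<Rightarrow> bool)" where
  "flip i x = x(i := \<not> x i)"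

lemma flip_flip [simp]: "flip i (flip i x) = x"
  by (auto simp: flip_def)

lemma flip_cylinder: "y \<in> cylinder x a \<Longrightarrow> flip i y \<in> cylinder (flip i x) a"
  by (auto simp: cylinder_def flip_def)

lemma flip_in_cylinder: "a \<le> i \<Longrightarrow> flip i x \<in> cylinder x a"
  by (auto simp: cylinder_def flip_def)

lemma dense_open_flip:
  assumes "dense_open D" shows "dense_open {x. flip i x \<in> D}"
  unfolding dense_open_def
proof (intro conjI ballI allI)
  fix x assume "x \<in> {x. flip i x \<in> D}"
  then obtain a where "cylinder (flip i x) a \<subseteq> D" using assms by (auto simp: dense_open_def)
  then have "cylinder x a \<subseteq> {x. flip i x \<in> D}" using flip_cylinder by blast
  then show "\<exists>a. cylinder x a \<subseteq> {x. flip i x \<in> D}" by blast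
next
  fix x a
  obtain y where "y \<in> D" "y \<in> cylinder (flip i x) a" using assms by (meson dense_open_def)
  then show "\<exists>y\<in>{x. flip i x \<in> D}. y \<in> cylinder x a"
    using flip_cylinder[of y "flip i x" a i] by (intro bexI[of _ "flip i y"]) simp_all
qed

text \<open>The hypothesis \<open>pow\<close> enters through an enumeration of short sequences: once
  for regularity, once to list the eventually zero sequences. The graph depends on
  \<open>label\<close>.\<close>

locale power_closed_cardinal =
  fixes label :: "'k::wellorder \<Rightarrow> 'k"
  assumes card: "Card_order (kappa :: 'k rel)"
    and unc: "uncountable (UNIV :: 'k set)"
    and pow: "|short_seqs :: ('k \<rightharpoonup> 'k) set| =o (kappa :: 'k rel)"
    and label_unbounded: "\<exists>\<gamma>\<ge>\<beta>. label \<gamma> = i"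
begin

subsection \<open>Regularity\<close>

lemma Field_kappa: "Field (kappa :: 'k rel) = UNIV"
  by (auto simp: kappa_def Field_def)

lemma underS_kappa: "underS (kappa :: 'k rel) a = {..<a}"
  by (auto simp: underS_def kappa_def)

lemma card_UNIV: "|UNIV :: 'k set| =o (kappa :: 'k rel)"
  using card_of_Field_ordIso[OF card] by (simp add: Field_kappa)

text \<open>\<kappa> is an initial ordinal, so its proper segments have smaller cardinality.\<close>

lemma segment_not_onto: "f ` {..<a::'k} \<noteq> (UNIV :: 'k set)"
proof
  assume "f ` {..<a} = UNIV"
  then have "|UNIV :: 'k set| \<le>o |{..<a}|" by (intro surj_imp_ordLeq[of _ f]) simp
  moreover have "|{..<a}| <o |UNIV :: 'k set|"
    using card_of_underS[OF card, of a] card_UNIV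
    by (metis Field_kappa UNIV_I ordIso_symmetric ordLess_ordIso_trans underS_kappa)
  ultimately show False using not_ordLess_ordLeq by blast
qed

lemma infinite_UNIV: "infinite (UNIV :: 'k set)"
  using unc countable_finite by blast

text \<open>Below a largest element there would be an infinite segment, which absorbs one more point
  and so could be mapped onto \<kappa>.\<close>

lemma no_max: "\<exists>b. (a::'k) < b"
proof (rule ccontr)
  assume "\<nexists>b. a < b"
  then have U: "UNIV = insert a {..<a}" by (auto simp: not_less order_le_less)
  then have "infinite {..<a}" using infinite_UNIV by (metis finite_insert)
  from infinite_imp_bij_betw2[OF this, of a] obtain h where "bij_betw h {..<a} ({..<a} \<union> {a})" ..
  then have "h ` {..<a} = UNIV" using U by (auto simp: bij_betw_def)
  then show False using segment_not_onto by blast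
qed

lemma less_next_ord: "(a::'k) < next_ord a"
  unfolding next_ord_def using no_max by (rule LeastI_ex)

lemma less_next_ord_iff: "(b::'k) < next_ord a \<longleftrightarrow> b \<le> a"
  using less_next_ord[of a] not_less_Least[of b "\<lambda>b. a < b"]
  unfolding next_ord_def by (meson linorder_not_le order.strict_trans1)

lemma next_ord_le_iff: "next_ord a \<le> (b::'k) \<longleftrightarrow> a < b"
  using less_next_ord_iff[of b a] by auto

lemma segment_atMost_not_onto: "f ` {..a::'k} \<noteq> (UNIV :: 'k set)"
  using segment_not_onto[of f "next_ord a"] by (simp add: lessThan_def less_next_ord_iff atMost_def)

lemma short_seqs_enumeration:
  obtains e :: "'k \<Rightarrow> ('k \<rightharpoonup> 'k)" where "short_seqs \<subseteq> range e"
proof -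
  have "|short_seqs :: ('k \<rightharpoonup> 'k) set| \<le>o |UNIV :: 'k set|"
    using pow card_UNIV by (meson ordIso_iff_ordLeq ordIso_symmetric ordIso_transitive)
  moreover have "short_seqs \<noteq> ({} :: ('k \<rightharpoonup> 'k) set)"
    using restrict_short_seqs[of _ id] by force
  ultimately obtain e :: "'k \<Rightarrow> ('k \<rightharpoonup> 'k)" where e: "range e = short_seqs"
    using card_of_ordLeq2[of "short_seqs :: ('k \<rightharpoonup> 'k) set" "UNIV :: 'k set"] by auto
  show thesis by (rule that[of e]) (simp add: e)
qed

text \<open>Koenig's argument: a cofinal map on a segment would allow diagonalising against an
  enumeration of all short sequences.\<close>

lemma segment_image_bounded:
  fixes f :: "'k \<Rightarrow> 'k"
  shows "\<exists>b. \<forall>\<xi><a. f \<xi> < b"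
proof -
  have "\<exists>b. \<forall>\<xi><a. f \<xi> \<le> b"
  proof (rule ccontr)
    assume "\<nexists>b. \<forall>\<xi><a. f \<xi> \<le> b"
    then have cof: "\<exists>\<xi><a. b < f \<xi>" for b by (meson not_less)
    obtain e :: "'k \<Rightarrow> ('k \<rightharpoonup> 'k)" where e: "short_seqs \<subseteq> range e"
      using short_seqs_enumeration .
    \<comment> \<open>Diagonal value: \<open>v \<xi>\<close> differs from the entry at
      \<open>\<xi>\<close> of every sequence enumerated up to \<open>f \<xi>\<close>. As
      \<open>f\<close> is cofinal, each index is covered by some \<open>\<xi> < a\<close>.\<close>
    define v where "v \<xi> = (SOME v. v \<notin> (\<lambda>\<eta>. the (e \<eta> \<xi>)) ` {..f \<xi>})" for \<xi>
    have v: "v \<xi> \<notin> (\<lambda>\<eta>. the (e \<eta> \<xi>)) ` {..f \<xi>}" for \<xi>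
    proof -
      have "\<exists>v. v \<notin> (\<lambda>\<eta>. the (e \<eta> \<xi>)) ` {..f \<xi>}"
        using segment_atMost_not_onto[of "\<lambda>\<eta>. the (e \<eta> \<xi>)" "f \<xi>"] by (metis UNIV_eq_I)
      then show ?thesis unfolding v_def by (rule someI_ex)
    qed
    define t where "t = (\<lambda>\<xi>. if \<xi> < a then Some (v \<xi>) else None)"
    have "t \<in> short_seqs" unfolding t_def by (rule restrict_short_seqs)
    then obtain \<eta> where \<eta>: "t = e \<eta>" using e by blast
    obtain \<xi> where "\<xi> < a" "\<eta> < f \<xi>" using cof by blast
    then have "the (e \<eta> \<xi>) \<noteq> v \<xi>" using v[of \<xi>] by (metis atMost_iff image_eqI less_imp_le)
    then show False using \<eta> \<open>\<xi> < a\<close> by (metis option.sel t_def)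
  qed
  then show ?thesis using no_max by (meson order.strict_trans1)
qed

text \<open>Some proper segment is infinite, since otherwise counting predecessors would inject
  \<kappa> into the natural numbers. Indexing the sequence by that segment reduces the claim to
  regularity.\<close>

lemma sequence_bounded:
  fixes f :: "nat \<Rightarrow> 'k"
  shows "\<exists>b. \<forall>n. f n < b"
proof -
  have "\<exists>a::'k. infinite {..<a}"
  proof (rule ccontr)
    assume fin: "\<not> ?thesis"
    have "inj (\<lambda>a::'k. card {..<a})"
    proof (rule linorder_injI)
      fix a b :: 'k assume "a < b"
      then have "{..<a} \<subset> {..<b}" by auto
      then show "card {..<a} \<noteq> card {..<b}" using fin by (metis psubset_card_mono nat_neq_iff)
    qed
    then have "countable (UNIV :: 'k set)" by (rule countableI)
    then show False using unc by blast
  qed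
  then obtain a :: 'k and g :: "nat \<Rightarrow> 'k" where g: "inj g" "range g \<subseteq> {..<a}"
    using infinite_countable_subset by blast
  obtain b where "\<forall>\<xi><a. f (inv g \<xi>) < b" using segment_image_bounded by blast
  then have "f n < b" for n using g by (metis inv_f_f lessThan_iff range_subsetD)
  then show ?thesis by blast
qed

lemma pairing: obtains p :: "'k \<Rightarrow> 'k \<times> 'k" where "surj p"
proof -
  have "|UNIV \<times> UNIV :: ('k \<times> 'k) set| =o |UNIV :: 'k set|"
    using card_of_Times_same_infinite[OF infinite_UNIV] .
  then obtain f :: "'k \<times> 'k \<Rightarrow> 'k" where "bij f"
    unfolding card_of_ordIso[symmetric] by auto
  then show thesis using that[of "inv f"] by (simp add: bij_betw_def inj_imp_surj_inv)
qed

subsection \<open>Fusion\<close>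

text \<open>Each coordinate is read off at the first stage that decides it; coherence makes every
  later stage agree.\<close>

lemma glue:
  fixes a :: "'k \<Rightarrow> 'k" and z :: "'k \<Rightarrow> 'k \<Rightarrow> 'b"
  assumes "\<And>\<xi> \<zeta>. \<xi> \<in> I \<Longrightarrow> \<zeta> \<in> I \<Longrightarrow> \<xi> < \<zeta> \<Longrightarrow> z \<zeta> \<in> cylinder (z \<xi>) (a \<xi>)"
    and "\<And>\<xi> \<zeta>. \<xi> \<in> I \<Longrightarrow> \<zeta> \<in> I \<Longrightarrow> \<xi> < \<zeta> \<Longrightarrow> a \<xi> < a \<zeta>"
    and "\<And>\<xi>. \<xi> \<in> I \<Longrightarrow> z \<xi> \<in> cylinder z0 a0"
  shows "\<exists>w \<in> cylinder z0 a0. \<forall>\<xi>\<in>I. w \<in> cylinder (z \<xi>) (a \<xi>)"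
proof -
  define m where "m \<beta> = (LEAST \<xi>. \<xi> \<in> I \<and> \<beta> < a \<xi>)" for \<beta>
  \<comment> \<open>Coordinates decided at no stage default to \<open>z0\<close>, which also covers
    an empty \<open>I\<close>.\<close>
  define w where "w \<beta> = (if \<exists>\<xi>\<in>I. \<beta> < a \<xi> then z (m \<beta>) \<beta> else z0 \<beta>)" for \<beta>
  have m: "m \<beta> \<in> I" "\<beta> < a (m \<beta>)" "m \<beta> \<le> \<xi>" if "\<xi> \<in> I" "\<beta> < a \<xi>" for \<beta> \<xi>
    using LeastI[of "\<lambda>\<xi>. \<xi> \<in> I \<and> \<beta> < a \<xi>" \<xi>] Least_le[of "\<lambda>\<xi>. \<xi> \<in> I \<and> \<beta> < a \<xi>" \<xi>] that
    unfolding m_def by auto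
  have "w \<beta> = z \<xi> \<beta>" if "\<xi> \<in> I" "\<beta> < a \<xi>" for \<beta> \<xi>
  proof -
    have "w \<beta> = z (m \<beta>) \<beta>" using that by (auto simp: w_def)
    moreover have "z \<xi> \<beta> = z (m \<beta>) \<beta>"
    proof (cases "m \<beta> = \<xi>")
      case False
      then have "m \<beta> < \<xi>" using m[OF that] by simp
      then show ?thesis using assms(1)[of "m \<beta>" \<xi>] m[OF that] that by (auto dest: cylinderD)
    qed simp
    ultimately show ?thesis by simp
  qed
  moreover have "w \<beta> = z0 \<beta>" if "\<beta> < a0" for \<beta>
    using cylinderD[OF assms(3) that] m(1) by (auto simp: w_def)
  ultimately show ?thesis by (auto simp: cylinder_def)
qed

text \<open>A construction of length \<open>\<kappa>\<close> by initial segments: \<open>\<phi> \<gamma>\<close> is an invariant that depends on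
  the values up to \<open>\<gamma>\<close> only, so it survives at limits automatically.\<close>

lemma fusion:
  fixes z0 :: "'k \<Rightarrow> 'b"
  assumes local: "\<And>\<gamma> z z'. z' \<in> cylinder z (next_ord \<gamma>) \<Longrightarrow> \<phi> \<gamma> z \<Longrightarrow> \<phi> \<gamma> z'"
    and init: "\<And>\<gamma>. \<gamma> < a0 \<Longrightarrow> \<phi> \<gamma> z0"
    and extend: "\<And>\<eta> a z. a0 \<le> a \<Longrightarrow> z \<in> cylinder z0 a0 \<Longrightarrow> (\<And>\<gamma>. \<gamma> < a \<Longrightarrow> \<phi> \<gamma> z) \<Longrightarrow>
      \<exists>b>a. \<exists>z'\<in>cylinder z a. (\<forall>\<gamma><b. \<phi> \<gamma> z') \<and> cylinder z' b \<subseteq> D \<eta>"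
  shows "\<exists>z\<in>cylinder z0 a0. (\<forall>\<gamma>. \<phi> \<gamma> z) \<and> (\<forall>\<eta>::'k. z \<in> D \<eta>)"
proof -
  have local': "\<phi> \<gamma> z'" if "z' \<in> cylinder z b" "\<gamma> < b" "\<phi> \<gamma> z" for \<gamma> b z z'
  proof -
    have "next_ord \<gamma> \<le> b" using that by (simp add: next_ord_le_iff)
    then show ?thesis using cylinder_mono[of "next_ord \<gamma>" b z] local that by blast
  qed
  \<comment> \<open>A stage is a height together with a sequence of which only the part below the
    height is fixed.\<close>
  define P where "P f \<eta> q \<longleftrightarrow> a0 < fst q \<and> snd q \<in> cylinder z0 a0 \<and> (\<forall>\<gamma><fst q. \<phi> \<gamma> (snd q)) \<and>
      cylinder (snd q) (fst q) \<subseteq> D \<eta> \<and>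
      (\<forall>\<xi><\<eta>. fst (f \<xi>) < fst q \<and> snd q \<in> cylinder (snd (f \<xi>)) (fst (f \<xi>)))"
    for f :: "'k \<Rightarrow> 'k \<times> ('k \<Rightarrow> 'b)" and \<eta> q
  have "\<exists>f. \<forall>\<eta>. P f \<eta> (f \<eta>)"
  proof (rule dependent_wellorder_choice)
    show "P f \<eta> q = P g \<eta> q" if "\<And>y. y < \<eta> \<Longrightarrow> f y = g y" for q f g \<eta>
      using that unfolding P_def by auto
  next
    fix \<eta> f assume IH: "\<And>\<xi>. \<xi> < \<eta> \<Longrightarrow> P f \<xi> (f \<xi>)"
    define B where "B a \<longleftrightarrow> a0 \<le> a \<and> (\<forall>\<xi><\<eta>. fst (f \<xi>) \<le> a)" for a
    have "\<exists>a. B a"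
    proof -
      obtain b where "\<forall>\<xi><\<eta>. fst (f \<xi>) < b" using segment_image_bounded[of \<eta> "\<lambda>\<xi>. fst (f \<xi>)"] by blast
      then have "B (max a0 b)" by (auto simp: B_def le_max_iff_disj intro: less_imp_le)
      then show ?thesis ..
    qed
    \<comment> \<open>Taking the least bound matters: every \<open>\<gamma> < a\<close> then lies
      below \<open>a0\<close> or below an earlier height, where the invariant passes to the glued
      \<open>w\<close>.\<close>
    define a where "a = (LEAST a. B a)"
    have a: "B a" unfolding a_def using \<open>\<exists>a. B a\<close> by (rule LeastI_ex)
    have "\<exists>w \<in> cylinder z0 a0. \<forall>\<xi>\<in>{..<\<eta>}. w \<in> cylinder (snd (f \<xi>)) (fst (f \<xi>))"
      by (rule glue) (use IH in \<open>auto simp: P_def\<close>)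
    then obtain w where w: "w \<in> cylinder z0 a0"
      "\<And>\<xi>. \<xi> < \<eta> \<Longrightarrow> w \<in> cylinder (snd (f \<xi>)) (fst (f \<xi>))" by auto
    have "\<phi> \<gamma> w" if "\<gamma> < a" for \<gamma>
    proof -
      have "\<not> B \<gamma>" using that not_less_Least unfolding a_def by blast
      then consider "\<gamma> < a0" | \<xi> where "\<xi> < \<eta>" "\<gamma> < fst (f \<xi>)" by (auto simp: B_def not_le)
      then show ?thesis
      proof cases
        case 1
        then show ?thesis using local' w init by blast
      next
        case 2
        then have "\<phi> \<gamma> (snd (f \<xi>))" using IH by (auto simp: P_def)
        then show ?thesis using local' w 2 by blast
      qed
    qed
    then obtain b z' where b: "a < b" "z' \<in> cylinder w a" "\<forall>\<gamma><b. \<phi> \<gamma> z'" "cylinder z' b \<subseteq> D \<eta>"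
      using extend[of a w \<eta>] a w by (auto simp: B_def)
    have "z' \<in> cylinder (snd (f \<xi>)) (fst (f \<xi>))" "fst (f \<xi>) < b" if "\<xi> < \<eta>" for \<xi>
      using a that b(1) cylinder_trans[OF w(2)[OF that] b(2)] by (auto simp: B_def)
    moreover have "z' \<in> cylinder z0 a0" "a0 < b"
      using a b(1) cylinder_trans[OF w(1) b(2)] by (auto simp: B_def)
    ultimately have "P f \<eta> (b, z')" using b by (simp add: P_def)
    then show "\<exists>q. P f \<eta> q" ..
  qed
  then obtain f where f: "\<And>\<eta>. P f \<eta> (f \<eta>)" by blast
  have "\<exists>w \<in> cylinder z0 a0. \<forall>\<xi>\<in>UNIV. w \<in> cylinder (snd (f \<xi>)) (fst (f \<xi>))"
    by (rule glue) (use f in \<open>auto simp: P_def\<close>)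
  then obtain w where w: "w \<in> cylinder z0 a0" "\<And>\<xi>. w \<in> cylinder (snd (f \<xi>)) (fst (f \<xi>))" by auto
  \<comment> \<open>Strictly increasing heights dominate their indices, so every
    \<open>\<gamma>\<close> is decided at some stage.\<close>
  have ge: "\<xi> \<le> fst (f \<xi>)" for \<xi>
  proof (induction \<xi> rule: less_induct)
    case (less \<xi>)
    show ?case
    proof (rule ccontr)
      assume "\<not> ?thesis"
      then have "fst (f \<xi>) < \<xi>" by simp
      moreover from this have "fst (f (fst (f \<xi>))) < fst (f \<xi>)"
        using f[of \<xi>] by (simp add: P_def)
      ultimately show False using less[of "fst (f \<xi>)"] by simp
    qed
  qed
  have "\<phi> \<gamma> w" for \<gamma>
  proof -
    have "\<gamma> < fst (f (next_ord \<gamma>))" using ge less_next_ord by (meson order.strict_trans2)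
    then show ?thesis using local'[OF w(2)] f[of "next_ord \<gamma>"] by (auto simp: P_def)
  qed
  moreover have "w \<in> D \<eta>" for \<eta> using f[of \<eta>] w(2)[of \<eta>] by (auto simp: P_def)
  ultimately show ?thesis using w by blast
qed

section \<open>Baire category and the Baire property\<close>

text \<open>Fusion with the trivial invariant; extending above \<open>next_ord a\<close> makes the
  heights increase strictly.\<close>

lemma Baire_category:
  fixes D :: "'k \<Rightarrow> ('k \<Rightarrow> bool) set"
  assumes "\<And>\<eta>. dense_open (D \<eta>)"
  shows "\<exists>z\<in>cylinder x a. \<forall>\<eta>. z \<in> D \<eta>"
proof -
  have "\<exists>z\<in>cylinder x a. (\<forall>\<gamma>::'k. True) \<and> (\<forall>\<eta>. z \<in> D \<eta>)"
  proof (rule fusion)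
    fix \<eta> a :: 'k and z :: "'k \<Rightarrow> bool"
    obtain y b where y: "y \<in> cylinder z (next_ord a)" "next_ord a \<le> b" "cylinder y b \<subseteq> D \<eta>"
      using dense_open_extend[OF assms] .
    then have "y \<in> cylinder z a" "a < b"
      using cylinder_mono[of a "next_ord a" z] less_next_ord[of a] by (auto simp: next_ord_le_iff less_imp_le)
    with y show "\<exists>b>a. \<exists>z'\<in>cylinder z a. (\<forall>\<gamma><b. True) \<and> cylinder z' b \<subseteq> D \<eta>" by blast
  qed auto
  then show ?thesis by simp
qed

text \<open>The sets that agree with an open set on an intersection of \<kappa> many dense open sets
  include the open sets and are closed under complements and unions of length \<kappa>.\<close>

lemma kappa_Borel_Baire_property:
  assumes "B \<in> kappa_Borel"
  shows "\<exists>U (D :: 'k \<Rightarrow> ('k \<Rightarrow> bool) set). openin bounded_topology U \<and> (\<forall>\<eta>. dense_open (D \<eta>)) \<and>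
    (\<forall>x. (\<forall>\<eta>. x \<in> D \<eta>) \<longrightarrow> (x \<in> B \<longleftrightarrow> x \<in> U))"
  using assms
proof induction
  case (Open U)
  then show ?case using dense_open_UNIV by (intro exI[of _ U] exI[of _ "\<lambda>_. UNIV"]) auto
next
  case (Compl A)
  then obtain U and D :: "'k \<Rightarrow> ('k \<Rightarrow> bool) set" where UD: "openin bounded_topology U"
    "\<And>\<eta>. dense_open (D \<eta>)" "\<And>x. (\<And>\<eta>. x \<in> D \<eta>) \<Longrightarrow> x \<in> A \<longleftrightarrow> x \<in> U" by blast
  \<comment> \<open>The interior of the complement of \<open>U\<close>. The boundary of
    \<open>U\<close> is nowhere dense, so \<open>U \<union> V\<close> may be added to the dense open
    conditions.\<close>
  define V where "V = {x. \<exists>a. cylinder x a \<subseteq> - U}"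
  have V_sub: "\<exists>a. cylinder x a \<subseteq> V" if x: "x \<in> V" for x
  proof -
    obtain a where a: "cylinder x a \<subseteq> - U" using x V_def by blast
    then have "cylinder y a \<subseteq> - U" if "y \<in> cylinder x a" for y
      using that cylinder_trans[of y x a _ a] by blast
    then show ?thesis by (auto simp: V_def)
  qed
  have "dense_open (U \<union> V)"
    unfolding dense_open_def
  proof (intro conjI ballI allI)
    fix x assume "x \<in> U \<union> V"
    then show "\<exists>a. cylinder x a \<subseteq> U \<union> V"
      using UD(1) V_sub unfolding openin_bounded_topology_iff by blast
  next
    fix x a
    show "\<exists>y\<in>U \<union> V. y \<in> cylinder x a"
    proof (cases "cylinder x a \<subseteq> - U")
      case True
      then have "x \<in> V" by (auto simp: V_def)
      then show ?thesis using cylinder_refl by blast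
    qed blast
  qed
  then have "dense_open (D \<eta> \<inter> (U \<union> V))" for \<eta> using UD(2) dense_open_Int by blast
  moreover have "U \<inter> V = {}" by (force simp: V_def)
  moreover have "openin bounded_topology V" using V_sub by (simp add: openin_bounded_topology_iff)
  ultimately show ?case
    using UD(3) by (intro exI[of _ V] exI[of _ "\<lambda>\<eta>. D \<eta> \<inter> (U \<union> V)"]) blast
next
  case (Union A)
  then obtain U and D :: "'k \<Rightarrow> 'k \<Rightarrow> ('k \<Rightarrow> bool) set" where UD: "\<And>\<alpha>. openin bounded_topology (U \<alpha>)"
    "\<And>\<alpha> \<eta>. dense_open (D \<alpha> \<eta>)" "\<And>\<alpha> x. (\<And>\<eta>. x \<in> D \<alpha> \<eta>) \<Longrightarrow> x \<in> A \<alpha> \<longleftrightarrow> x \<in> U \<alpha>"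
    by metis
  \<comment> \<open>The pairing turns the doubly indexed dense open sets into one family of length
    \<kappa>.\<close>
  obtain p :: "'k \<Rightarrow> 'k \<times> 'k" where p: "surj p" using pairing .
  show ?case
  proof (intro exI conjI allI impI)
    show "openin bounded_topology (\<Union>\<alpha>. U \<alpha>)" using UD(1) by blast
    show "dense_open (case_prod D (p \<eta>))" for \<eta> using UD(2) by (simp add: case_prod_beta)
    fix x assume *: "\<forall>\<eta>. x \<in> case_prod D (p \<eta>)"
    have "x \<in> D \<alpha> \<eta>" for \<alpha> \<eta> using * p by (metis case_prod_conv surjD)
    then show "x \<in> (\<Union>\<alpha>. A \<alpha>) \<longleftrightarrow> x \<in> (\<Union>\<alpha>. U \<alpha>)" using UD(3) by simp
  qed
qed

subsection \<open>The graph\<close>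

text \<open>The least ordinal satisfies this vacuously and successors never do; \<open>coded\<close>
  asks for \<open>\<delta> > i\<close>, which excludes the vacuous case.\<close>

definition limit_of_ones :: "('k \<Rightarrow> bool) \<Rightarrow> 'k \<Rightarrow> bool" where
  "limit_of_ones x \<delta> \<longleftrightarrow> (\<forall>\<epsilon><\<delta>. \<exists>\<xi>>\<epsilon>. \<xi> < \<delta> \<and> x \<xi>)"

definition first_one :: "('k \<Rightarrow> bool) \<Rightarrow> 'k \<Rightarrow> 'k \<Rightarrow> bool" where
  "first_one x \<delta> \<gamma> \<longleftrightarrow> \<delta> \<le> \<gamma> \<and> x \<gamma> \<and> (\<forall>\<xi><\<gamma>. \<delta> \<le> \<xi> \<longrightarrow> \<not> x \<xi>)"

text \<open>Keeping \<open>\<gamma>\<close> as a parameter makes each instance depend only on the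
  values up to \<open>\<gamma>\<close>, as closedness and the fusion invariant both require.\<close>

definition coded :: "'k \<Rightarrow> 'k \<Rightarrow> ('k \<Rightarrow> bool) \<Rightarrow> ('k \<Rightarrow> bool) \<Rightarrow> bool" where
  "coded i \<gamma> x y \<longleftrightarrow>
    (\<forall>\<delta>>i. limit_of_ones x \<delta> \<and> limit_of_ones y \<delta> \<and> first_one x \<delta> \<gamma> \<longrightarrow> label \<gamma> = i)"

definition label_graph :: "('k \<Rightarrow> bool) rel" where
  "label_graph = {(x, y). \<exists>i. y \<in> cylinder x i \<and> x i \<noteq> y i \<and> (\<forall>\<gamma>. coded i \<gamma> x y \<and> coded i \<gamma> y x)}"

lemma limit_of_ones_local:
  assumes "x' \<in> cylinder x b" "\<delta> \<le> b"
  shows "limit_of_ones x' \<delta> \<longleftrightarrow> limit_of_ones x \<delta>"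
  using cylinderD[OF assms(1)] assms(2) unfolding limit_of_ones_def
  by (meson order.strict_trans2)

lemma first_one_local:
  assumes "x' \<in> cylinder x b" "\<gamma> < b"
  shows "first_one x' \<delta> \<gamma> \<longleftrightarrow> first_one x \<delta> \<gamma>"
  using cylinderD[OF assms(1)] assms(2) unfolding first_one_def
  by (meson order.strict_trans)

text \<open>A \<open>\<delta>\<close> whose first one is at \<open>\<gamma>\<close> is at most
  \<open>\<gamma>\<close>, so the limit conditions too are read below \<open>b\<close>.\<close>

lemma coded_local:
  assumes "x' \<in> cylinder x b" "y' \<in> cylinder y b" "\<gamma> < b"
  shows "coded i \<gamma> x' y' \<longleftrightarrow> coded i \<gamma> x y"
proof -
  have "\<delta> \<le> b" if "first_one x \<delta> \<gamma>" for \<delta>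
    using that assms(3) by (auto simp: first_one_def)
  then show ?thesis
    unfolding coded_def first_one_local[OF assms(1,3)]
    using limit_of_ones_local[OF assms(1)] limit_of_ones_local[OF assms(2)] by blast
qed

lemma graph_on_label_graph: "graph_on UNIV label_graph"
proof -
  have "sym label_graph"
    by (rule symI) (auto simp: label_graph_def intro: cylinder_sym[THEN iffD1])
  moreover have "(x, x) \<notin> label_graph" for x by (simp add: label_graph_def)
  ultimately show ?thesis by (auto simp: graph_on_def)
qed

text \<open>A height above both the first difference and a \<open>\<gamma>\<close> at which the
  coding fails preserves the failure.\<close>

lemma label_graph_complement_local:
  assumes "x \<noteq> y" "(x, y) \<notin> label_graph"
  shows "\<exists>b. \<forall>x'\<in>cylinder x b. \<forall>y'\<in>cylinder y b. (x', y') \<notin> label_graph"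
proof -
  define i where "i = (LEAST i. x i \<noteq> y i)"
  have "\<exists>i. x i \<noteq> y i" using assms(1) by (auto simp: fun_eq_iff)
  then have i: "x i \<noteq> y i" unfolding i_def by (rule LeastI_ex)
  have below: "x \<xi> = y \<xi>" if "\<xi> < i" for \<xi> using that not_less_Least unfolding i_def by blast
  then have "y \<in> cylinder x i" by (simp add: cylinder_def)
  then obtain \<gamma> where \<gamma>: "\<not> (coded i \<gamma> x y \<and> coded i \<gamma> y x)"
    using assms(2) i unfolding label_graph_def by blast
  define b where "b = max (next_ord \<gamma>) (next_ord i)"
  have b: "\<gamma> < b" "i < b" using less_next_ord by (auto simp: b_def less_max_iff_disj)
  have "(x', y') \<notin> label_graph" if x': "x' \<in> cylinder x b" and y': "y' \<in> cylinder y b" for x' y'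
  proof
    assume "(x', y') \<in> label_graph"
    then obtain j where j: "y' \<in> cylinder x' j" "x' j \<noteq> y' j" "coded j \<gamma> x' y'" "coded j \<gamma> y' x'"
      by (auto simp: label_graph_def)
    have eq: "x' \<xi> = x \<xi>" "y' \<xi> = y \<xi>" if "\<xi> \<le> i" for \<xi>
      using cylinderD[OF x'] cylinderD[OF y'] that b(2) by auto
    have "\<not> i < j" using j(1) i eq[of i] by (auto dest: cylinderD)
    moreover have "\<not> j < i" using j(2) eq[of j] below[of j] by (metis less_imp_le)
    ultimately have "j = i" by simp
    then show False
      using \<gamma> j coded_local[OF x' y' b(1)] coded_local[OF y' x' b(1)] by blast
  qed
  then show ?thesis by blast
qed

lemma closed_label_graph: "closed_graph bounded_topology label_graph"
proof -
  let ?Q = "(UNIV :: ('k \<Rightarrow> bool) set) \<times> UNIV - Id_on UNIV"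
  let ?T = "subtopology (prod_topology bounded_topology bounded_topology) ?Q"
  have "\<exists>W. openin ?T W \<and> p \<in> W \<and> W \<subseteq> ?Q - label_graph" if p: "p \<in> ?Q - label_graph" for p
  proof -
    obtain x y where xy: "p = (x, y)" by (cases p)
    then obtain b where b: "\<forall>x'\<in>cylinder x b. \<forall>y'\<in>cylinder y b. (x', y') \<notin> label_graph"
      using label_graph_complement_local[of x y] p by (auto simp: Id_on_def)
    have "openin ?T (?Q \<inter> cylinder x b \<times> cylinder y b)"
      by (intro openin_subtopology_Int2 openin_prod_Times_iff[THEN iffD2] disjI2 conjI openin_cylinder)
    moreover have "p \<in> ?Q \<inter> cylinder x b \<times> cylinder y b" using p xy by simp
    moreover have "?Q \<inter> cylinder x b \<times> cylinder y b \<subseteq> ?Q - label_graph" using b by blast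
    ultimately show ?thesis by blast
  qed
  then have "openin ?T (?Q - label_graph)"
    unfolding openin_subopen[of _ "?Q - label_graph"] by blast
  moreover have "label_graph \<subseteq> ?Q" using graph_on_label_graph unfolding graph_on_def by blast
  ultimately show ?thesis
    using graph_on_label_graph by (simp add: closed_graph_def closedin_def)
qed

section \<open>Edges inside comeager sets and the failure of colorings\<close>

text \<open>While \<open>x\<close> is extended into \<open>D\<close>, the partner \<open>y\<close> stays zero, so no common limit of ones
  arises; the first ones written from \<open>a\<close> on are placed at positions labelled \<open>i\<close>.\<close>

lemma extend_coded_pair:
  assumes D: "dense_open D"
    and xy: "\<And>\<gamma>. \<gamma> < a \<Longrightarrow> coded i \<gamma> x y \<and> coded i \<gamma> y x"
  obtains b x' y' where "a < b" "x' \<in> cylinder x a" "y' \<in> cylinder y a"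
    "\<And>\<gamma>. \<gamma> < b \<Longrightarrow> coded i \<gamma> x' y' \<and> coded i \<gamma> y' x'" "cylinder x' b \<subseteq> D"
proof -
  obtain \<gamma>1 where \<gamma>1: "a \<le> \<gamma>1" "label \<gamma>1 = i" using label_unbounded by blast
  \<comment> \<open>The one at \<open>\<gamma>1\<close> comes before the extension into
    \<open>D\<close>: it answers any common limit up to \<open>a\<close>, whatever \<open>D\<close>
    demands later.\<close>
  define x1 where "x1 \<xi> = (if \<xi> < a then x \<xi> else \<xi> = \<gamma>1)" for \<xi>
  obtain x2 c where x2: "x2 \<in> cylinder x1 (next_ord \<gamma>1)" "next_ord \<gamma>1 \<le> c" "cylinder x2 c \<subseteq> D"
    using dense_open_extend[OF D] .
  obtain \<gamma>2 where \<gamma>2: "c \<le> \<gamma>2" "label \<gamma>2 = i" using label_unbounded by blast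
  have "\<gamma>1 < c" using x2(2) by (simp add: next_ord_le_iff)
  define b where "b = next_ord \<gamma>2"
  have b: "\<gamma> < b \<longleftrightarrow> \<gamma> \<le> \<gamma>2" for \<gamma> by (simp add: b_def less_next_ord_iff)
  \<comment> \<open>Zeros from \<open>c\<close> on keep \<open>x'\<close> inside the cylinder
    reached in \<open>D\<close>, while \<open>y'\<close> waits for its single new one at
    \<open>\<gamma>2\<close>.\<close>
  define x' where "x' \<xi> = (if \<xi> < c then x2 \<xi> else False)" for \<xi>
  define y' where "y' \<xi> = (if \<xi> < a then y \<xi> else \<xi> = \<gamma>2)" for \<xi>
  have x'1: "x' \<xi> = x1 \<xi>" if "\<xi> \<le> \<gamma>1" for \<xi>
    using cylinderD[OF x2(1)] that order.strict_trans1[OF that \<open>\<gamma>1 < c\<close>]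
    by (simp add: x'_def less_next_ord_iff)
  have x': "x' \<in> cylinder x a"
    using \<gamma>1(1) x'1 by (auto simp: cylinder_def x1_def)
  have y': "y' \<in> cylinder y a" by (simp add: cylinder_def y'_def)
  \<comment> \<open>Since \<open>y'\<close> has no ones in the interval from \<open>a\<close> up to
    but excluding \<open>\<gamma>2\<close>, no new common limit can arise there.\<close>
  have le: "\<delta> \<le> a" if lim: "limit_of_ones y' \<delta>" and "\<delta> \<le> \<gamma>2" for \<delta>
  proof (rule ccontr)
    assume "\<not> \<delta> \<le> a"
    then obtain \<xi> where "a < \<xi>" "\<xi> < \<delta>" "y' \<xi>" using lim unfolding limit_of_ones_def not_le by blast
    then show False using \<open>\<delta> \<le> \<gamma>2\<close> by (auto simp: y'_def)
  qed
  show thesis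
  proof (rule that)
    show "a < b" using \<gamma>1(1) \<gamma>2(1) \<open>\<gamma>1 < c\<close> by (auto simp: b)
    show "x' \<in> cylinder x a" "y' \<in> cylinder y a" by fact+
    have "cylinder x' b \<subseteq> cylinder x2 c"
      using \<gamma>2(1) by (auto simp: cylinder_def x'_def b)
    then show "cylinder x' b \<subseteq> D" using x2(3) by blast
    fix \<gamma> assume "\<gamma> < b"
    then have "\<gamma> \<le> \<gamma>2" by (simp add: b)
    show "coded i \<gamma> x' y' \<and> coded i \<gamma> y' x'"
    proof (cases "\<gamma> < a")
      case True
      then show ?thesis using xy coded_local[OF x' y'] coded_local[OF y' x'] by blast
    next
      case False
      \<comment> \<open>The relevant limit is at most \<open>a\<close>, so the one at
        \<open>\<gamma>1\<close> bounds \<open>\<gamma>\<close>; at or above \<open>a\<close> there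
        is no earlier one of \<open>x'\<close>.\<close>
      have "label \<gamma> = i" if "limit_of_ones y' \<delta>" "first_one x' \<delta> \<gamma>" for \<delta>
      proof -
        have "\<delta> \<le> \<gamma>1" using le[OF that(1)] that(2) \<open>\<gamma> \<le> \<gamma>2\<close> \<gamma>1(1) by (force simp: first_one_def)
        moreover have "x' \<gamma>1" using x'1[of \<gamma>1] \<gamma>1(1) by (simp add: x1_def leD)
        ultimately have "\<gamma> \<le> \<gamma>1" using that(2) unfolding first_one_def by (meson not_le)
        then have "\<gamma> = \<gamma>1" using that(2) x'1[of \<gamma>] False by (auto simp: first_one_def x1_def)
        then show ?thesis using \<gamma>1(2) by simp
      qed
      moreover have "label \<gamma> = i" if "first_one y' \<delta> \<gamma>" for \<delta>
        using that False \<gamma>2(2) by (auto simp: first_one_def y'_def)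
      ultimately show ?thesis by (auto simp: coded_def)
    qed
  qed
qed

text \<open>Fusion on sequences of pairs builds both ends at once. Each stage extends
  \<open>x\<close> into \<open>D \<eta>\<close> and then, with the roles exchanged,
  \<open>y\<close>.\<close>

lemma label_graph_edge_generic:
  fixes D :: "'k \<Rightarrow> ('k \<Rightarrow> bool) set"
  assumes D: "\<And>\<eta>. dense_open (D \<eta>)"
  obtains x y where "x \<in> cylinder w i" "y \<in> cylinder w i" "(x, y) \<in> label_graph"
    "\<And>\<eta>. x \<in> D \<eta>" "\<And>\<eta>. y \<in> D \<eta>"
proof -
  define z0 where "z0 = (\<lambda>\<xi>. (w \<xi>, if \<xi> = i then \<not> w \<xi> else w \<xi>))"
  define \<phi> where "\<phi> \<gamma> z \<longleftrightarrow> coded i \<gamma> (fst \<circ> z) (snd \<circ> z) \<and> coded i \<gamma> (snd \<circ> z) (fst \<circ> z)"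
    for \<gamma> and z :: "'k \<Rightarrow> bool \<times> bool"
  define E where "E \<eta> = {z. fst \<circ> z \<in> D \<eta> \<and> snd \<circ> z \<in> D \<eta>}" for \<eta>
  have proj: "fst \<circ> z' \<in> cylinder (fst \<circ> z) b" "snd \<circ> z' \<in> cylinder (snd \<circ> z) b"
    if "z' \<in> cylinder z b" for z z' :: "'k \<Rightarrow> bool \<times> bool" and b
    using that by (auto simp: cylinder_def)
  have "\<exists>z\<in>cylinder z0 (next_ord i). (\<forall>\<gamma>. \<phi> \<gamma> z) \<and> (\<forall>\<eta>. z \<in> E \<eta>)"
  proof (rule fusion)
    show "\<phi> \<gamma> z'" if "z' \<in> cylinder z (next_ord \<gamma>)" "\<phi> \<gamma> z" for \<gamma> z z'
      using that(2) coded_local[OF proj(1)[OF that(1)] proj(2)[OF that(1)] less_next_ord]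
        coded_local[OF proj(2)[OF that(1)] proj(1)[OF that(1)] less_next_ord]
      by (simp add: \<phi>_def)
    \<comment> \<open>Vacuous: for \<open>\<gamma> \<le> i\<close> there is no
      \<open>\<delta>\<close> with \<open>i < \<delta> \<le> \<gamma>\<close>.\<close>
    show "\<phi> \<gamma> z0" if "\<gamma> < next_ord i" for \<gamma>
      using that by (auto simp: \<phi>_def coded_def first_one_def less_next_ord_iff)
    fix \<eta> a z assume "\<And>\<gamma>. \<gamma> < a \<Longrightarrow> \<phi> \<gamma> z"
    then have "\<And>\<gamma>. \<gamma> < a \<Longrightarrow> coded i \<gamma> (fst \<circ> z) (snd \<circ> z) \<and> coded i \<gamma> (snd \<circ> z) (fst \<circ> z)"
      by (simp add: \<phi>_def)
    from extend_coded_pair[OF D this] obtain b x y where 1: "a < b" "x \<in> cylinder (fst \<circ> z) a"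
      "y \<in> cylinder (snd \<circ> z) a" "\<And>\<gamma>. \<gamma> < b \<Longrightarrow> coded i \<gamma> x y \<and> coded i \<gamma> y x" "cylinder x b \<subseteq> D \<eta>"
      by blast
    from 1(4) have "\<And>\<gamma>. \<gamma> < b \<Longrightarrow> coded i \<gamma> y x \<and> coded i \<gamma> x y" by blast
    from extend_coded_pair[OF D this] obtain c y' x' where 2: "b < c" "y' \<in> cylinder y b"
      "x' \<in> cylinder x b" "\<And>\<gamma>. \<gamma> < c \<Longrightarrow> coded i \<gamma> y' x' \<and> coded i \<gamma> x' y'" "cylinder y' c \<subseteq> D \<eta>"
      by blast
    define z' where "z' = (\<lambda>\<xi>. (x' \<xi>, y' \<xi>))"
    have z': "fst \<circ> z' = x'" "snd \<circ> z' = y'" by (auto simp: z'_def)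
    have "z' \<in> cylinder z a"
      using 1(1-3) 2(2,3) by (auto simp: cylinder_def z'_def prod_eq_iff)
    moreover have "\<forall>\<gamma><c. \<phi> \<gamma> z'" using 2(4) by (simp add: \<phi>_def z')
    moreover have "cylinder z' c \<subseteq> E \<eta>"
    proof
      fix v assume "v \<in> cylinder z' c"
      then have "fst \<circ> v \<in> cylinder x' c" "snd \<circ> v \<in> cylinder y' c" using proj z' by metis+
      then have "fst \<circ> v \<in> cylinder x b" "snd \<circ> v \<in> D \<eta>"
        using cylinder_trans[OF 2(3)] 2(1,5) by auto
      then show "v \<in> E \<eta>" using 1(5) by (auto simp: E_def)
    qed
    ultimately show "\<exists>b>a. \<exists>z'\<in>cylinder z a. (\<forall>\<gamma><b. \<phi> \<gamma> z') \<and> cylinder z' b \<subseteq> E \<eta>"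
      using 1(1) 2(1) by (meson order.strict_trans)
  qed
  then obtain z where z: "z \<in> cylinder z0 (next_ord i)" "\<And>\<gamma>. \<phi> \<gamma> z" "\<And>\<eta>. z \<in> E \<eta>" by blast
  have eq: "z \<xi> = z0 \<xi>" if "\<xi> \<le> i" for \<xi> using cylinderD[OF z(1)] that by (simp add: less_next_ord_iff)
  show thesis
  proof (rule that)
    show "fst \<circ> z \<in> cylinder w i" "snd \<circ> z \<in> cylinder w i"
      using eq by (auto simp: cylinder_def z0_def)
    have "snd \<circ> z \<in> cylinder (fst \<circ> z) i" using eq by (auto simp: cylinder_def z0_def)
    moreover have "(fst \<circ> z) i \<noteq> (snd \<circ> z) i" using eq[of i] by (simp add: z0_def)
    ultimately show "(fst \<circ> z, snd \<circ> z) \<in> label_graph"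
      using z(2) unfolding label_graph_def \<phi>_def by blast
    show "fst \<circ> z \<in> D \<eta>" "snd \<circ> z \<in> D \<eta>" for \<eta> using z(3)[of \<eta>] by (auto simp: E_def)
  qed
qed

text \<open>On generic points each color class agrees with an open set. A cylinder inside one of
  these contains an edge between generic points, whose ends then share a color.\<close>

lemma no_kappa_Borel_coloring: "\<not> kappa_Borel_coloring label_graph c"
proof
  assume c: "kappa_Borel_coloring label_graph c"
  then have "\<forall>\<alpha>. \<exists>U (D :: 'k \<Rightarrow> ('k \<Rightarrow> bool) set). openin bounded_topology U \<and>
      (\<forall>\<eta>. dense_open (D \<eta>)) \<and> (\<forall>x. (\<forall>\<eta>. x \<in> D \<eta>) \<longrightarrow> (x \<in> c -` {\<alpha>} \<longleftrightarrow> x \<in> U))"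
    unfolding kappa_Borel_coloring_def by (intro allI kappa_Borel_Baire_property) blast
  then obtain U and D :: "'k \<Rightarrow> 'k \<Rightarrow> ('k \<Rightarrow> bool) set" where UD: "\<And>\<alpha>. openin bounded_topology (U \<alpha>)"
    "\<And>\<alpha> \<eta>. dense_open (D \<alpha> \<eta>)" "\<And>\<alpha> x. (\<And>\<eta>. x \<in> D \<alpha> \<eta>) \<Longrightarrow> x \<in> c -` {\<alpha>} \<longleftrightarrow> x \<in> U \<alpha>"
    by metis
  obtain p :: "'k \<Rightarrow> 'k \<times> 'k" where p: "surj p" using pairing .
  define E where "E \<eta> = case_prod D (p \<eta>)" for \<eta>
  have E: "dense_open (E \<eta>)" for \<eta> using UD(2) by (simp add: E_def case_prod_beta)
  have color: "c x = \<alpha> \<longleftrightarrow> x \<in> U \<alpha>" if "\<And>\<eta>. x \<in> E \<eta>" for x \<alpha>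
  proof -
    have "x \<in> D \<alpha> \<eta>" for \<eta> using that p unfolding E_def by (metis case_prod_conv surjD)
    then show ?thesis using UD(3)[of x \<alpha>] by simp
  qed
  obtain x where x: "\<And>\<eta>. x \<in> E \<eta>" using Baire_category[of E] E by blast
  then have "x \<in> U (c x)" using color by blast
  then obtain a where a: "cylinder x a \<subseteq> U (c x)" using UD(1) by (meson openin_bounded_topology_iff)
  obtain y z where yz: "y \<in> cylinder x a" "z \<in> cylinder x a" "(y, z) \<in> label_graph"
    "\<And>\<eta>. y \<in> E \<eta>" "\<And>\<eta>. z \<in> E \<eta>"
    using label_graph_edge_generic[of E x a] E by metis
  then have "c y = c x" "c z = c x" using color a by blast+
  then show False using c yz(3) by (auto simp: kappa_Borel_coloring_def)
qed

section \<open>Common limits of ones and uniqueness of the label\<close>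

definition unbounded_ones :: "('k \<Rightarrow> bool) \<Rightarrow> bool" where
  "unbounded_ones x \<longleftrightarrow> (\<forall>a. \<exists>\<xi>>a. x \<xi>)"

text \<open>Iterate a function \<open>g\<close> such that each of the three sequences has a one
  strictly between \<open>b\<close> and \<open>g b\<close>. The supremum of the \<omega> iterates
  stays below \<kappa> by \<open>sequence_bounded\<close>.\<close>

lemma common_limit_of_ones:
  assumes "unbounded_ones x" "unbounded_ones y" "unbounded_ones z"
  shows "\<exists>\<delta>>a. limit_of_ones x \<delta> \<and> limit_of_ones y \<delta> \<and> limit_of_ones z \<delta>"
proof -
  have "\<exists>c. (\<exists>\<xi>>b. \<xi> < c \<and> x \<xi>) \<and> (\<exists>\<xi>>b. \<xi> < c \<and> y \<xi>) \<and> (\<exists>\<xi>>b. \<xi> < c \<and> z \<xi>)" for b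
  proof -
    obtain \<xi> \<zeta> \<nu> where \<xi>: "b < \<xi>" "x \<xi>" "b < \<zeta>" "y \<zeta>" "b < \<nu>" "z \<nu>"
      using assms unfolding unbounded_ones_def by meson
    obtain c where "max \<xi> (max \<zeta> \<nu>) < c" using no_max by blast
    with \<xi> show ?thesis by auto
  qed
  then obtain g where g: "\<And>b. (\<exists>\<xi>>b. \<xi> < g b \<and> x \<xi>) \<and> (\<exists>\<xi>>b. \<xi> < g b \<and> y \<xi>) \<and> (\<exists>\<xi>>b. \<xi> < g b \<and> z \<xi>)"
    by metis
  define s where "s n = (g ^^ n) a" for n
  have s: "s (Suc n) = g (s n)" for n by (simp add: s_def)
  define \<delta> where "\<delta> = (LEAST b. \<forall>n. s n < b)"
  have \<delta>: "s n < \<delta>" for n using LeastI_ex[OF sequence_bounded[of s]] unfolding \<delta>_def by blast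
  have ex: "\<exists>n. \<epsilon> \<le> s n" if "\<epsilon> < \<delta>" for \<epsilon>
    using not_less_Least[of \<epsilon> "\<lambda>b. \<forall>n. s n < b"] that unfolding \<delta>_def by (meson not_less)
  have lim: "limit_of_ones w \<delta>" if w: "\<And>b. \<exists>\<xi>>b. \<xi> < g b \<and> w \<xi>" for w
    unfolding limit_of_ones_def
  proof (intro allI impI)
    fix \<epsilon> assume "\<epsilon> < \<delta>"
    then obtain n where n: "\<epsilon> \<le> s n" using ex by blast
    obtain \<xi> where "\<xi> > s n" "\<xi> < s (Suc n)" "w \<xi>" using w s by metis
    then show "\<exists>\<xi>>\<epsilon>. \<xi> < \<delta> \<and> w \<xi>" using n \<delta>[of "Suc n"] by (meson order.strict_trans order.strict_trans1)
  qed
  have "a < \<delta>" using \<delta>[of 0] by (simp add: s_def)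
  then show ?thesis using g lim by blast
qed

text \<open>At a common limit above \<open>i\<close> and \<open>j\<close>, the first one of
  \<open>x\<close> carries a single label, which must equal both.\<close>

lemma coded_unique:
  assumes "unbounded_ones x" "unbounded_ones y" "unbounded_ones y'"
    and "\<And>\<gamma>. coded i \<gamma> x y" "\<And>\<gamma>. coded j \<gamma> x y'"
  shows "i = j"
proof -
  obtain \<delta> where \<delta>: "max i j < \<delta>" "limit_of_ones x \<delta>" "limit_of_ones y \<delta>" "limit_of_ones y' \<delta>"
    using common_limit_of_ones[OF assms(1-3)] by blast
  define \<gamma> where "\<gamma> = (LEAST \<gamma>. \<delta> \<le> \<gamma> \<and> x \<gamma>)"
  have "\<exists>\<gamma>. \<delta> \<le> \<gamma> \<and> x \<gamma>" using assms(1) by (meson less_imp_le unbounded_ones_def)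
  then have "\<delta> \<le> \<gamma> \<and> x \<gamma>" unfolding \<gamma>_def by (rule LeastI_ex)
  moreover have "\<not> x \<xi>" if "\<delta> \<le> \<xi>" "\<xi> < \<gamma>" for \<xi>
    using not_less_Least that unfolding \<gamma>_def by blast
  ultimately have "first_one x \<delta> \<gamma>" by (auto simp: first_one_def)
  then have "label \<gamma> = i" "label \<gamma> = j"
    using \<delta> assms(4,5)[of \<gamma>] by (auto simp: coded_def)
  then show ?thesis by simp
qed

text \<open>Such a sequence is determined by a short one. Two elements \<open>u\<close> and
  \<open>v\<close> of \<kappa> encode the bits, and undefined entries are read as zero.\<close>

lemma bounded_ones_enumeration:
  obtains e :: "'k \<Rightarrow> ('k \<Rightarrow> bool)" where "{x. \<not> unbounded_ones x} \<subseteq> range e"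
proof -
  obtain e :: "'k \<Rightarrow> ('k \<rightharpoonup> 'k)" where e: "short_seqs \<subseteq> range e"
    using short_seqs_enumeration .
  obtain u v :: 'k where uv: "u < v" using no_max by blast
  show thesis
  proof (rule that[of "\<lambda>\<eta> \<xi>. e \<eta> \<xi> = Some v"])
    show "{x. \<not> unbounded_ones x} \<subseteq> range (\<lambda>\<eta> \<xi>. e \<eta> \<xi> = Some v)"
    proof
      fix x assume "x \<in> {x. \<not> unbounded_ones x}"
      then obtain a where a: "\<And>\<xi>. \<xi> > a \<Longrightarrow> \<not> x \<xi>" by (auto simp: unbounded_ones_def)
      define t where "t = (\<lambda>\<xi>. if \<xi> < next_ord a then Some (if x \<xi> then v else u) else None)"
      have "t \<in> short_seqs" unfolding t_def by (rule restrict_short_seqs)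
      then obtain \<eta> where "t = e \<eta>" using e by blast
      moreover have "x \<xi> \<longleftrightarrow> t \<xi> = Some v" for \<xi>
        using a[of \<xi>] uv by (auto simp: t_def less_next_ord_iff)
      ultimately show "x \<in> range (\<lambda>\<eta> \<xi>. e \<eta> \<xi> = Some v)" by (auto simp: fun_eq_iff)
    qed
  qed
qed

subsection \<open>Homomorphisms\<close>

text \<open>Regularity provides a candidate for the \<open>LEAST\<close> in the recursion, so the
  recursion has its intended meaning.\<close>

lemma
  fixes \<alpha> :: 'k
  shows ord_plus_strict: "\<delta> < \<gamma> \<Longrightarrow> ord_plus \<alpha> \<delta> < ord_plus \<alpha> \<gamma>"
    and ord_plus_least: "\<alpha> \<le> \<beta> \<Longrightarrow> (\<And>\<delta>. \<delta> < \<gamma> \<Longrightarrow> ord_plus \<alpha> \<delta> < \<beta>) \<Longrightarrow> ord_plus \<alpha> \<gamma> \<le> \<beta>"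
proof -
  obtain b where "\<forall>\<xi><\<gamma>. ord_plus \<alpha> \<xi> < b" using segment_image_bounded by blast
  then have "\<exists>\<beta>. \<alpha> \<le> \<beta> \<and> (\<forall>\<delta>\<in>{..<\<gamma>}. ord_plus \<alpha> \<delta> < \<beta>)"
    by (intro exI[of _ "max \<alpha> b"]) (auto simp: less_max_iff_disj)
  from LeastI_ex[OF this] show "\<delta> < \<gamma> \<Longrightarrow> ord_plus \<alpha> \<delta> < ord_plus \<alpha> \<gamma>"
    by (auto simp: ord_plus.simps[of \<alpha> \<gamma>])
  show "\<alpha> \<le> \<beta> \<Longrightarrow> (\<And>\<delta>. \<delta> < \<gamma> \<Longrightarrow> ord_plus \<alpha> \<delta> < \<beta>) \<Longrightarrow> ord_plus \<alpha> \<gamma> \<le> \<beta>"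
    unfolding ord_plus.simps[of \<alpha> \<gamma>] by (intro Least_le) auto
qed

text \<open>Left subtraction of ordinals: the least \<open>\<gamma>\<close> with
  \<open>\<beta> \<le> ord_plus \<alpha> \<gamma>\<close> works. This justifies the
  \<open>THE\<close> in \<open>seq_concat\<close>.\<close>

lemma ord_plus_onto:
  assumes "(\<alpha>::'k) \<le> \<beta>" shows "\<exists>!\<gamma>. ord_plus \<alpha> \<gamma> = \<beta>"
proof -
  have "\<gamma> \<le> ord_plus \<alpha> \<gamma>" for \<gamma>
  proof (induction \<gamma> rule: less_induct)
    case (less \<gamma>)
    show ?case
    proof (rule ccontr)
      assume "\<not> ?thesis"
      then have *: "ord_plus \<alpha> \<gamma> < \<gamma>" by simp
      with less[OF *] ord_plus_strict[OF *, of \<alpha>] show False by simp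
    qed
  qed
  then have ex: "\<exists>\<gamma>. \<beta> \<le> ord_plus \<alpha> \<gamma>" by blast
  define \<gamma> where "\<gamma> = (LEAST \<gamma>. \<beta> \<le> ord_plus \<alpha> \<gamma>)"
  have "\<beta> \<le> ord_plus \<alpha> \<gamma>" unfolding \<gamma>_def using ex by (rule LeastI_ex)
  moreover have "ord_plus \<alpha> \<delta> < \<beta>" if "\<delta> < \<gamma>" for \<delta>
    using not_less_Least[of \<delta> "\<lambda>\<gamma>. \<beta> \<le> ord_plus \<alpha> \<gamma>"] that by (auto simp: \<gamma>_def not_le)
  ultimately have "ord_plus \<alpha> \<gamma> = \<beta>" using ord_plus_least[OF assms] by (meson antisym)
  moreover have "\<gamma>' = \<gamma>''" if "ord_plus \<alpha> \<gamma>' = ord_plus \<alpha> \<gamma>''" for \<gamma>' \<gamma>''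
    using that ord_plus_strict[of \<gamma>' \<gamma>'' \<alpha>] ord_plus_strict[of \<gamma>'' \<gamma>' \<alpha>] by (metis less_irrefl neqE)
  ultimately show ?thesis by blast
qed

lemma seq_length_eq: "dom t = {..<\<alpha>} \<Longrightarrow> seq_length t = (\<alpha>::'k)"
  unfolding seq_length_def by (rule the_equality) (auto simp: lessThan_eq_iff)

text \<open>With the tail of \<open>x\<close> beyond \<open>\<alpha>\<close> shifted back to the
  origin, concatenation merely overwrites \<open>x\<close> by \<open>t\<close>.\<close>

lemma seq_concat_tail:
  assumes "dom t = {..<\<alpha>::'k}"
  shows "seq_concat t (\<lambda>\<gamma>. x (ord_plus \<alpha> \<gamma>)) = (\<lambda>\<beta>. case t \<beta> of Some b \<Rightarrow> b | None \<Rightarrow> x \<beta>)"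
proof
  fix \<beta>
  show "seq_concat t (\<lambda>\<gamma>. x (ord_plus \<alpha> \<gamma>)) \<beta> = (case t \<beta> of Some b \<Rightarrow> b | None \<Rightarrow> x \<beta>)"
  proof (cases "t \<beta>")
    case None
    then have "\<alpha> \<le> \<beta>" using assms by (metis domIff lessThan_iff not_less)
    from theI'[OF ord_plus_onto[OF this]] show ?thesis
      using None by (simp add: seq_concat_def seq_length_eq[OF assms])
  qed (simp add: seq_concat_def)
qed

text \<open>Appending a bit and the tail of \<open>x\<close> beyond \<open>i\<close> to
  \<open>u\<close> gives \<open>x\<close> with that bit at \<open>i\<close>; the two bits give
  \<open>x\<close> and \<open>flip i x\<close>.\<close>

lemma G0_graph_flip:
  fixes S :: "('k \<rightharpoonup> bool) set"
  assumes "u \<in> S" "dom u = {..<i}" "x \<in> basic_open u"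
  shows "(x, flip i x) \<in> G0_graph S"
proof -
  define w where "w = (\<lambda>\<gamma>. x (ord_plus (next_ord i) \<gamma>))"
  have *: "seq_concat (seq_snoc u b) w = x(i := b)" for b
  proof -
    have dom: "dom (seq_snoc u b) = {..<next_ord i}"
      using assms(2) by (auto simp: seq_snoc_def seq_length_eq[OF assms(2)] less_next_ord_iff)
    have "x \<beta> = b'" if "u \<beta> = Some b'" for \<beta> b'
      using assms(3) that by (force simp: basic_open_def map_le_def)
    then show ?thesis
      unfolding w_def seq_concat_tail[OF dom]
      by (auto simp: seq_snoc_def seq_length_eq[OF assms(2)] fun_eq_iff split: option.split)
  qed
  have "x(i := x i) = x" by simp
  then have "{x(i := False), x(i := True)} = {x, flip i x}"
    unfolding flip_def by (cases "x i") auto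
  moreover have "(x(i := False), x(i := True)) \<in> {(seq_concat (seq_snoc t False) x, seq_concat (seq_snoc t True) x) | t x. t \<in> S}"
    using assms(1) *[symmetric] by blast
  ultimately show ?thesis
    unfolding G0_graph_def Let_def by (cases "x i") (auto simp: flip_def doubleton_eq_iff fun_upd_idem)
qed

text \<open>For a generic \<open>x\<close>, neither \<open>f x\<close> nor any \<open>f (flip i x)\<close> is eventually zero. The first
  difference between \<open>f x\<close> and \<open>f (flip i x)\<close> then does not depend on \<open>i\<close>, although \<open>flip i x\<close>
  is adjacent to \<open>x\<close> for unboundedly many \<open>i\<close>.\<close>

lemma no_continuous_hom:
  fixes S :: "('k \<rightharpoonup> bool) set"
  assumes S: "upwards_dense S"
    and cont: "continuous_map bounded_topology bounded_topology f"
    and hom: "graph_hom UNIV (G0_graph S) UNIV label_graph f"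
  shows False
proof -
  define hits where "hits i x \<longleftrightarrow> (\<exists>u\<in>S. dom u = {..<i} \<and> x \<in> basic_open u)" for i :: 'k and x
  have edge: "(f x, f (flip i x)) \<in> label_graph" if "hits i x" for i x
  proof -
    have "(x, flip i x) \<in> G0_graph S" using that G0_graph_flip unfolding hits_def by blast
    then show ?thesis using hom by (auto simp: graph_hom_def)
  qed
  have hits_local: "hits i y" if "hits i x" "y \<in> cylinder x i" for i x y
    using that basic_open_cylinder[of _ i x] unfolding hits_def by blast
  have hits_dense: "\<exists>i\<ge>a. \<exists>y\<in>cylinder x a. hits i y" for x a
  proof -
    define t where "t = (\<lambda>\<xi>. if \<xi> < a then Some (x \<xi>) else None)"
    have "t \<in> short_seqs" unfolding t_def by (rule restrict_short_seqs)
    then obtain u where u: "u \<in> S" "t \<subseteq>\<^sub>m u" using S by (auto simp: upwards_dense_def)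
    then obtain i where i: "dom u = {..<i}" using S by (auto simp: upwards_dense_def short_seqs_def)
    define y where "y \<xi> = (case u \<xi> of Some b \<Rightarrow> b | None \<Rightarrow> x \<xi>)" for \<xi>
    have "dom t = {..<a}" by (auto simp: t_def dom_def)
    then have "{..<a} \<subseteq> {..<i}" using map_le_implies_dom_le[OF u(2)] i by simp
    then have "a \<le> i" by (metis lessThan_subset_iff)
    moreover have "y \<in> basic_open u" by (auto simp: basic_open_def map_le_def y_def)
    moreover have "y \<in> basic_open t"
      using u(2) \<open>y \<in> basic_open u\<close> map_le_trans unfolding basic_open_def by blast
    then have "y \<in> cylinder x a" unfolding cylinder_eq_basic_open t_def .
    ultimately show ?thesis using u(1) i unfolding hits_def by blast
  qed
  \<comment> \<open>Density holds because arbitrarily close to any point there are two adjacent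
    points; their images are adjacent, hence distinct, so one of them differs from
    \<open>z\<close>.\<close>
  have avoid: "dense_open {x. f x \<noteq> z}" for z
    unfolding dense_open_def
  proof (intro conjI ballI allI)
    fix x assume "x \<in> {x. f x \<noteq> z}"
    then obtain \<xi> where \<xi>: "f x \<xi> \<noteq> z \<xi>" by (auto simp: fun_eq_iff)
    obtain a where "f ` cylinder x a \<subseteq> cylinder (f x) (next_ord \<xi>)"
      using continuous_bounded_topologyD[OF cont] by blast
    then have "f y \<xi> = f x \<xi>" if "y \<in> cylinder x a" for y
      using that cylinderD less_next_ord by blast
    then show "\<exists>a. cylinder x a \<subseteq> {x. f x \<noteq> z}" using \<xi> by blast
  next
    fix x a
    obtain i y where iy: "a \<le> i" "y \<in> cylinder x a" "hits i y" using hits_dense by blast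
    then have "f y \<noteq> f (flip i y)" using edge graph_on_label_graph by (fastforce simp: graph_on_def)
    moreover have "flip i y \<in> cylinder x a"
      using cylinder_trans[OF iy(2) flip_in_cylinder[OF iy(1)]] by simp
    ultimately show "\<exists>y\<in>{x. f x \<noteq> z}. y \<in> cylinder x a" using iy(2) by blast
  qed
  have hit: "dense_open {x. \<exists>i\<ge>j. hits i x}" for j
    unfolding dense_open_def
  proof (intro conjI ballI allI)
    fix x assume "x \<in> {x. \<exists>i\<ge>j. hits i x}"
    then obtain i where "j \<le> i" "hits i x" by blast
    then have "cylinder x i \<subseteq> {x. \<exists>i\<ge>j. hits i x}" using hits_local[of i x] by blast
    then show "\<exists>a. cylinder x a \<subseteq> {x. \<exists>i\<ge>j. hits i x}" ..
  next
    fix x a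
    obtain i y where "max a j \<le> i" "y \<in> cylinder x (max a j)" "hits i y" using hits_dense by blast
    then show "\<exists>y\<in>{x. \<exists>i\<ge>j. hits i x}. y \<in> cylinder x a"
      using cylinder_mono[of a "max a j" x] by auto
  qed
  obtain e :: "'k \<Rightarrow> ('k \<Rightarrow> bool)" where e: "{x. \<not> unbounded_ones x} \<subseteq> range e"
    using bounded_ones_enumeration .
  obtain p :: "'k \<Rightarrow> 'k \<times> 'k" where p: "surj p" using pairing .
  \<comment> \<open>Every \<open>flip i x\<close> has to avoid the enumerated sequences, as the
    coordinates at which \<open>x\<close> has neighbours are not known in advance.\<close>
  define E where "E i \<eta> = {x. f x \<noteq> e \<eta>} \<inter> {x. \<exists>j\<ge>i. hits j x} \<inter> {x. flip i x \<in> {x. f x \<noteq> e \<eta>}}"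
    for i \<eta>
  have "dense_open (case_prod E (p \<eta>))" for \<eta>
    unfolding case_prod_beta E_def by (intro dense_open_Int avoid hit dense_open_flip)
  then obtain x where x: "\<And>\<eta>. x \<in> case_prod E (p \<eta>)"
    using Baire_category[of "\<lambda>\<eta>. case_prod E (p \<eta>)"] by blast
  have x: "x \<in> E i \<eta>" for i \<eta> using x p by (metis case_prod_conv surjD)
  have ne: "f x \<noteq> e \<eta>" "f (flip i x) \<noteq> e \<eta>" for i \<eta> using x[of i \<eta>] by (auto simp: E_def)
  have fx: "unbounded_ones (f x)" using ne(1) e by blast
  have flips: "unbounded_ones (f (flip i x))" for i using ne(2)[of i] e by blast
  have hits: "\<exists>i\<ge>j. hits i x" for j using x by (auto simp: E_def)
  obtain i where "hits i x" using hits by blast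
  then obtain k where k: "\<And>\<gamma>. coded k \<gamma> (f x) (f (flip i x))"
    using edge by (force simp: label_graph_def)
  \<comment> \<open>Flipping a coordinate at or above \<open>a\<close> leaves the image unchanged up
    to and including \<open>k\<close>, while \<open>coded_unique\<close> forces a neighbour's image
    to differ at \<open>k\<close>.\<close>
  obtain a where a: "f ` cylinder x a \<subseteq> cylinder (f x) (next_ord k)"
    using continuous_bounded_topologyD[OF cont] by blast
  obtain j where j: "a \<le> j" "hits j x" using hits by blast
  then obtain l where l: "f x l \<noteq> f (flip j x) l" "\<And>\<gamma>. coded l \<gamma> (f x) (f (flip j x))"
    using edge by (force simp: label_graph_def)
  have "l = k" using coded_unique[OF fx flips flips l(2) k] .
  moreover have "f (flip j x) \<in> cylinder (f x) (next_ord k)" using a flip_in_cylinder[OF j(1)] by blast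
  ultimately show False using l(1) cylinderD[OF _ less_next_ord] by metis
qed

end

section \<open>Existence of the labelling and conclusion\<close>

text \<open>Read off the first component through a bijection of \<kappa> with its square. Each fibre
  has \<kappa> elements, and a bounded set has fewer.\<close>

lemma labelling_exists:
  assumes "Card_order (kappa :: 'k::wellorder rel)" "infinite (UNIV :: 'k::wellorder set)"
  obtains label :: "'k::wellorder \<Rightarrow> 'k" where "\<forall>\<beta> i. \<exists>\<gamma>\<ge>\<beta>. label \<gamma> = i"
proof -
  have F: "Field (kappa :: 'k rel) = UNIV" by (auto simp: kappa_def Field_def)
  have "|UNIV \<times> UNIV :: ('k \<times> 'k) set| =o |UNIV :: 'k set|"
    using card_of_Times_same_infinite[OF assms(2)] .
  then obtain f :: "'k \<times> 'k \<Rightarrow> 'k" where f: "bij f"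
    unfolding card_of_ordIso[symmetric] by auto
  show thesis
  proof (rule that[of "fst \<circ> inv f"], intro allI)
    fix \<beta> i
    have "\<exists>j. \<beta> \<le> f (i, j)"
    proof (rule ccontr)
      assume "\<nexists>j. \<beta> \<le> f (i, j)"
      then have "range (\<lambda>j. f (i, j)) \<subseteq> {..<\<beta>}" by (auto simp: not_le)
      moreover have "inj (\<lambda>j. f (i, j))" 
        using bij_is_inj[OF f] by (intro injI) (simp add: inj_eq)
      ultimately have "|UNIV :: 'k set| \<le>o |{..<\<beta>}|" 
        by (intro card_of_ordLeqI[of "\<lambda>j. f (i, j)"]) auto
      moreover have "|underS (kappa :: 'k rel) \<beta>| <o (kappa :: 'k rel)"
        using card_of_underS[OF assms(1)] F by blast
      moreover have "underS (kappa :: 'k rel) \<beta> = {..<\<beta>}" by (auto simp: underS_def kappa_def)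
      moreover have "|UNIV :: 'k set| =o (kappa :: 'k rel)"
        using card_of_Field_ordIso[OF assms(1)] F by simp
      ultimately show False
        by (metis not_ordLess_ordLeq ordIso_symmetric ordLess_ordIso_trans)
    qed
    then obtain j where "\<beta> \<le> f (i, j)" ..
    then show "\<exists>\<gamma>\<ge>\<beta>. (fst \<circ> inv f) \<gamma> = i"
      using f by (intro exI[of _ "f (i, j)"]) (simp add: bij_is_inj)
  qed
qed

theorem theorem1p1:
  fixes S :: "('k::wellorder \<rightharpoonup> bool) set"
  assumes "Card_order (kappa :: 'k rel)"
    and "uncountable (UNIV :: 'k set)"
    and "|short_seqs :: ('k \<rightharpoonup> 'k) set| =o (kappa :: 'k rel)"
    and "upwards_dense S"
    and "inj_on seq_length S"
  shows "\<exists>G :: ('k \<Rightarrow> bool) rel.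
    closed_graph bounded_topology G \<and>
    (\<nexists>c. kappa_Borel_coloring G c) \<and>
    (\<nexists>f. continuous_map bounded_topology bounded_topology f \<and>
      graph_hom UNIV (G0_graph S) UNIV G f)"
proof -
  have "infinite (UNIV :: 'k set)" using assms(2) countable_finite by blast
  then obtain label :: "'k \<Rightarrow> 'k" where "\<forall>\<beta> i. \<exists>\<gamma>\<ge>\<beta>. label \<gamma> = i"
    using labelling_exists[OF assms(1)] by metis
  then interpret power_closed_cardinal label
    using assms(1-3) by unfold_locales auto
  show ?thesis
    using closed_label_graph no_kappa_Borel_coloring no_continuous_hom[OF assms(4)] by blast
qed

end
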